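(* Let $\lambda_1,\lambda_2,\lambda_3\ge 0$, $c\in\mathbb{R}$, and let $\alpha_1,\alpha_2,\alpha_3\ge 2$ be even integers. Then the three-variable polynomial $$\lambda_1\lambda_2\big(x_1^{2\alpha_1}+x_2^{2\alpha_2}\big)x_3^{\alpha_3}+\lambda_1\lambda_3\big(x_1^{2\alpha_1}+x_3^{2\alpha_3}\big)x_2^{\alpha_2}+\lambda_2\lambda_3\big(x_2^{2\alpha_2}+x_3^{2\alpha_3}\big)x_1^{\alpha_1}+(\lambda_1^2+\lambda_2^2+\lambda_3^2-c)\,x_1^{\alpha_1}x_2^{\alpha_2}x_3^{\alpha_3}$$ is non-convex, i.e. it is not a convex function on $\mathbb{R}^3$.
   Context: These are the three-variable members of the AHI family $\sum_{i<j}\lambda_i\lambda_j(x^{2\alpha(i)}+x^{2\alpha(j)})\prod_{k\neq i,j}x^{\alpha(k)}+(\sum_i\lambda_i^2-c)\prod_i x^{\alpha(i)}$ with squared monomials $x^{\alpha(i)}=x_i^{\alpha_i}$.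
   Formalization: The polynomial is additionally assumed not to be identically zero; otherwise (at most one λ_i nonzero and c = λ_1²+λ_2²+λ_3², e.g. all λ_i = 0 and c = 0) it is the zero function, which is convex. *)

theory Defs
  imports "HOL-Analysis.Analysis"
begin

(* The polynomial, as a function.  All its coefficients vanish exactly when at most one
   of l1, l2, l3 is nonzero and c = l1^2 + l2^2 + l3^2; it is then the zero polynomial,
   which is convex, so the theorem assumes ahi3 not to be identically zero. *)
definition ahi3 ::
  "real \<Rightarrow> real \<Rightarrow> real \<Rightarrow> real \<Rightarrow> nat \<Rightarrow> nat \<Rightarrow> nat \<Rightarrow> real ^ 3 \<Rightarrow> real"
where
  "ahi3 l1 l2 l3 c a1 a2 a3 x =
      l1 * l2 * ((x $ 1) ^ (2 * a1) + (x $ 2) ^ (2 * a2)) * (x $ 3) ^ a3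
    + l1 * l3 * ((x $ 1) ^ (2 * a1) + (x $ 3) ^ (2 * a3)) * (x $ 2) ^ a2
    + l2 * l3 * ((x $ 2) ^ (2 * a2) + (x $ 3) ^ (2 * a3)) * (x $ 1) ^ a1
    + (l1\<^sup>2 + l2\<^sup>2 + l3\<^sup>2 - c) * (x $ 1) ^ a1 * (x $ 2) ^ a2 * (x $ 3) ^ a3"

end

theory Submission
  imports Defs
begin

text \<open>
  Every monomial of the polynomial involves at least two of the three variables, so the
  polynomial vanishes on the coordinate axes.  The axes have all of space as their convex
  hull, so a convex function that vanishes on them is nowhere positive; as it is zero at the
  origin, it cannot be negative anywhere either, since convexity would force a positive value
  at the opposite point.  Hence the only convex function vanishing on the axes is zero, which
  is \<open>convex_vanishing_on_axes_eq_0\<close>.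
\<close>

lemma convex_nonpos_eq_0:
  fixes f :: "'a::real_vector \<Rightarrow> real"
  assumes convex: "convex_on UNIV f" and nonpos: "\<And>x. f x \<le> 0" and "f 0 = 0"
  shows "f x = 0"
proof -
  have "f ((1 - 1/2) *\<^sub>R x + (1/2) *\<^sub>R (- x)) \<le> (1 - 1/2) * f x + (1/2) * f (- x)"
    by (rule convex_onD[OF convex]) auto
  then have "0 \<le> f x + f (- x)"
    using \<open>f 0 = 0\<close> by simp
  with nonpos[of x] nonpos[of "- x"] show ?thesis
    by linarith
qed

text \<open>
  A point is the average of its coordinate projections, each stretched by the dimension; these
  lie on the axes, so Jensen's inequality bounds the function above by zero.
\<close>

lemma convex_vanishing_on_axes_eq_0:
  fixes f :: "real ^ 'n \<Rightarrow> real"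
  assumes convex: "convex_on UNIV f" and axes: "\<And>i t. f (axis i t) = 0"
  shows "f x = 0"
proof (rule convex_nonpos_eq_0[OF convex])
  fix x :: "real ^ 'n"
  let ?n = "real CARD('n)"
  have "x = (\<Sum>i\<in>UNIV. (1 / ?n) *\<^sub>R axis i (?n * x $ i))"
    by (simp add: vec_eq_iff axis_def if_distrib sum.delta cong: if_cong)
  moreover have "f (\<Sum>i\<in>UNIV. (1 / ?n) *\<^sub>R axis i (?n * x $ i))
      \<le> (\<Sum>i\<in>UNIV. (1 / ?n) * f (axis i (?n * x $ i)))"
    by (rule convex_on_sum[OF _ _ convex]) auto
  ultimately show "f x \<le> 0"
    by (simp add: axes)
next
  show "f 0 = 0"
    using axes by (metis axis_eq_0_iff)
qed

lemma ahi3_axis_eq_0: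
  assumes "a1 > 0" and "a2 > 0" and "a3 > 0"
  shows "ahi3 l1 l2 l3 c a1 a2 a3 (axis i t) = 0"
  using assms exhaust_3[of i] by (auto simp: ahi3_def axis_def power_0_left)

theorem theorem3p3:
  fixes l1 l2 l3 c :: real and a1 a2 a3 :: nat
  assumes "l1 \<ge> 0" and "l2 \<ge> 0" and "l3 \<ge> 0"
    and "a1 \<ge> 2" and "even a1"
    and "a2 \<ge> 2" and "even a2"
    and "a3 \<ge> 2" and "even a3"
    and "ahi3 l1 l2 l3 c a1 a2 a3 \<noteq> (\<lambda>x. 0)"
  shows "\<not> convex_on UNIV (ahi3 l1 l2 l3 c a1 a2 a3)"
proof
  assume "convex_on UNIV (ahi3 l1 l2 l3 c a1 a2 a3)"
  then have "ahi3 l1 l2 l3 c a1 a2 a3 x = 0" for x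
    by (rule convex_vanishing_on_axes_eq_0) (rule ahi3_axis_eq_0; use assms in linarith)
  with assms(10) show False
    by (simp add: fun_eq_iff)
qed

end
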